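(* Let $F$ be a field with $\operatorname{char}(F)\neq 2$ and let $L$ be a $5$-dimensional pure nilpotent Lie algebra over $F$ with $b(L)=2$ and $\dim Z(L)=2=\dim[L,L]$, where $Z(L)$ is the center of $L$. Then $L$ has a basis $\{x_1,x_2,x_3,z_1,z_2\}$ in which the nonzero products of basis vectors (up to antisymmetry) are exactly $[x_1,x_2]=z_1$ and $[x_1,x_3]=z_2$.
   Context: For a finite dimensional Lie algebra $L$ and $x\in L$, $\operatorname{ad}_x:L\to L$ denotes the map $y\mapsto [x,y]$. The breadth of $L$ is $b(L)=\max\{\operatorname{rank}(\operatorname{ad}_x)\mid x\in L\}$. A Lie algebra is called pure if it does not have a (nonzero) abelian ideal as a direct summand; equivalently, $Z(L)\subseteq [L,L]$. *)

theory Defs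
  imports Main "HOL-Computational_Algebra.Computational_Algebra"
begin

text \<open>As for \<^locale>\<open>vector_space\<close>, the underlying set of the Lie algebra is the whole type.
  Finite-dimensionality is not part of the locale; it is entailed by a statement of the form
  \<open>dim UNIV = n\<close> with \<open>n > 0\<close>, since \<open>dim\<close> is \<open>0\<close> on infinite-dimensional spaces.\<close>

locale lie_algebra = vector_space scale
  for scale :: "'a::field \<Rightarrow> 'b::ab_group_add \<Rightarrow> 'b" (infixr \<open>*s\<close> 75) +
  fixes bracket :: "'b \<Rightarrow> 'b \<Rightarrow> 'b"
  assumes bracket_add_left: "bracket (x + y) z = bracket x z + bracket y z"
    and bracket_add_right: "bracket x (y + z) = bracket x y + bracket x z"
    and bracket_scale_left: "bracket (c *s x) y = c *s bracket x y"
    and bracket_scale_right: "bracket x (c *s y) = c *s bracket x y"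
    and bracket_self: "bracket x x = 0"
    and jacobi: "bracket x (bracket y z) + bracket y (bracket z x) + bracket z (bracket x y) = 0"
begin

definition ad :: "'b \<Rightarrow> 'b \<Rightarrow> 'b"
  where "ad x = (\<lambda>y. bracket x y)"

text \<open>The rank of a linear map is the dimension of its range. The set of ranks is finite, so that
  \<open>Max\<close> is meaningful, when the algebra is finite-dimensional.\<close>

definition breadth :: nat
  where "breadth = Max {dim (range (ad x)) | x. True}"

definition center :: "'b set"
  where "center = {z. \<forall>x. bracket x z = 0}"

definition product :: "'b set \<Rightarrow> 'b set \<Rightarrow> 'b set"
  where "product A B = span {bracket a b | a b. a \<in> A \<and> b \<in> B}"

definition derived :: "'b set"
  where "derived = product UNIV UNIV"

primrec lower_central :: "nat \<Rightarrow> 'b set"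
  where
    "lower_central 0 = UNIV"
  | "lower_central (Suc n) = product UNIV (lower_central n)"

definition nilpotent :: bool
  where "nilpotent \<longleftrightarrow> (\<exists>n. lower_central n = {0})"

definition lie_ideal :: "'b set \<Rightarrow> bool"
  where "lie_ideal I \<longleftrightarrow> subspace I \<and> (\<forall>x. \<forall>y\<in>I. bracket x y \<in> I)"

definition abelian :: "'b set \<Rightarrow> bool"
  where "abelian A \<longleftrightarrow> (\<forall>x\<in>A. \<forall>y\<in>A. bracket x y = 0)"

text \<open>Internal direct sum of Lie algebras: both summands are ideals.\<close>

definition direct_summand :: "'b set \<Rightarrow> bool"
  where "direct_summand I \<longleftrightarrow> lie_ideal I \<and>
    (\<exists>J. lie_ideal J \<and> I \<inter> J = {0} \<and> {a + b | a b. a \<in> I \<and> b \<in> J} = UNIV)"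

definition pure :: bool
  where "pure \<longleftrightarrow> \<not> (\<exists>A. A \<noteq> {0} \<and> abelian A \<and> direct_summand A)"

end

end

theory Submission
  imports Defs
begin

text \<open>Purity forces \<open>Z(L) \<subseteq> [L,L]\<close>, and since both spaces have dimension two they coincide, so all
  brackets are central. Let \<open>a\<close> be an element attaining the breadth two: as its rank is
  \<open>dim [L,L]\<close>, the map \<open>ad a\<close> is onto \<open>[L,L]\<close>, which therefore has a basis of the form
  \<open>z\<^sub>1 = [a,y]\<close>, \<open>z\<^sub>2 = [a,w]\<close>. Adding multiples of \<open>a\<close> to \<open>y\<close> and \<open>w\<close> does not affect \<open>z\<^sub>1\<close> and
  \<open>z\<^sub>2\<close>, but it changes \<open>[y,w]\<close> by an arbitrary linear combination of them; as \<open>[y,w]\<close> is itself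
  such a combination, it can be made to vanish.

  In the list of \<open>a\<close>, the corrected \<open>y\<close> and \<open>w\<close>, and the independent \<open>z\<^sub>1\<close> and \<open>z\<^sub>2\<close>, each of the
  first three elements lies outside the span of those after it, as is detected by the bracket
  with \<open>a\<close> or with the corrected \<open>y\<close>. So the list is independent, and being of length five it is
  a basis.\<close>

context lie_algebra
begin

lemma bracket_zero_right [simp]: "bracket x 0 = 0"
  using bracket_add_right[of x 0 0] by simp

lemma bracket_antisym: "bracket x y = - bracket y x"
proof -
  have "bracket (x + y) (x + y) = bracket x y + bracket y x"
    unfolding bracket_add_left bracket_add_right by (simp add: bracket_self)
  then show ?thesis
    unfolding bracket_self eq_neg_iff_add_eq_0 by (rule sym)
qed

lemma subspace_preimage_ad: "subspace S \<Longrightarrow> subspace {v. bracket x v \<in> S}"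
  by (auto simp: subspace_def bracket_add_right bracket_scale_right)

lemma subspace_centralizer: "subspace {v. bracket x v = 0}"
  using subspace_preimage_ad[OF subspace_single_0, of x] by simp

lemma subspace_center: "subspace center"
  by (auto simp: subspace_def center_def bracket_add_right bracket_scale_right)

lemma subspace_derived: "subspace derived"
  unfolding derived_def product_def by (rule subspace_span)

lemma bracket_in_derived: "bracket x y \<in> derived"
  unfolding derived_def product_def by (rule span_base) blast

lemma subspace_range_ad: "subspace (range (ad x))"
  unfolding subspace_def ad_def
  by (auto simp flip: bracket_add_right bracket_scale_right intro: rev_image_eqI[of 0])

lemma lie_ideal_if_contains_derived:
  "subspace I \<Longrightarrow> derived \<subseteq> I \<Longrightarrow> lie_ideal I"
  unfolding lie_ideal_def using bracket_in_derived by blast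

text \<open>A central \<open>z\<close> outside \<open>[L,L]\<close> would span an abelian direct summand: a basis of the whole
  algebra can be chosen to contain \<open>z\<close> and to have a basis of \<open>[L,L]\<close> among its other members,
  and these other members then span an ideal complementing the line through \<open>z\<close>.\<close>

lemma pure_imp_center_subset_derived:
  assumes pure
  shows "center \<subseteq> derived"
proof (rule ccontr)
  assume "\<not> center \<subseteq> derived"
  then obtain z where z: "z \<in> center" "z \<notin> derived"
    by blast
  obtain D where D: "D \<subseteq> derived" "independent D" "derived \<subseteq> span D"
    using basis_exists[of derived] by metis
  have "span D \<subseteq> derived"
    by (rule span_minimal[OF D(1) subspace_derived])
  then have "z \<notin> span D"
    using z(2) by blast
  then have "independent (insert z D)"
    by (rule independent_insertI[OF _ D(2)])
  then obtain B where B: "insert z D \<subseteq> B" "independent B" "span B = UNIV"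
    by (rule maximal_independent_subset_extend[OF subset_UNIV]) blast
  define J where "J = span (B - {z})"
  have "D \<subseteq> B - {z}"
    using B(1) D(1) z(2) by auto
  then have "derived \<subseteq> J"
    unfolding J_def using D(3) span_mono by blast
  then have J_ideal: "lie_ideal J"
    by (intro lie_ideal_if_contains_derived) (simp_all add: J_def)
  have z_J: "z \<notin> J"
    unfolding J_def using B(1,2) by (auto simp: dependent_def)
  have z_right: "bracket x v = 0" if "v \<in> span {z}" for x v
    using z(1) that by (auto simp: span_singleton center_def bracket_scale_right)
  have "lie_ideal (span {z})"
    unfolding lie_ideal_def by (simp add: z_right span_zero)
  moreover have "span {z} \<inter> J = {0}"
  proof -
    have "c = 0" if "c *s z \<in> J" for c
    proof (rule ccontr)
      assume "c \<noteq> 0"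
      then have "z = inverse c *s (c *s z)"
        by simp
      then show False
        using z_J that unfolding J_def by (metis span_scale)
    qed
    then have "span {z} \<inter> J \<subseteq> {0}"
      by (auto simp: span_singleton)
    then show ?thesis
      using span_zero unfolding J_def by blast
  qed
  moreover have "{a + b | a b. a \<in> span {z} \<and> b \<in> J} = UNIV"
  proof -
    have "insert z (B - {z}) = B"
      using B(1) by auto
    then have "span ({z} \<union> (B - {z})) = UNIV"
      using B(3) by simp
    then show ?thesis
      unfolding J_def by (simp only: span_Un)
  qed
  ultimately have "direct_summand (span {z})"
    unfolding direct_summand_def using J_ideal by blast
  moreover have "abelian (span {z})"
    by (simp add: abelian_def z_right)
  moreover have "z \<noteq> 0"
    using z(2) subspace_derived subspace_0 by blast
  then have "span {z} \<noteq> {0}"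
    using span_base[of z "{z}"] by blast
  ultimately show False
    using assms unfolding pure_def by blast
qed

text \<open>The bound on dimensions makes the set of ranks finite; on an infinite set \<open>Max\<close> would be an
  unspecified value.\<close>

lemma breadth_attained:
  assumes "\<And>S. dim S \<le> n"
  obtains x where "dim (range (ad x)) = breadth"
proof -
  let ?R = "{dim (range (ad x)) | x. True}"
  have "?R \<subseteq> {..n}"
    using assms by auto
  then have "finite ?R"
    using finite_subset by blast
  then have "Max ?R \<in> ?R"
    by (intro Max_in) auto
  then show ?thesis
    using that unfolding breadth_def by auto
qed

text \<open>The freedom of moving \<open>y\<close> and \<open>w\<close> along \<open>a\<close> suffices to cancel their bracket.\<close>

lemma commuting_modification:
  assumes "bracket y w \<in> span {bracket a y, bracket a w}"
  obtains y' w' where "bracket a y' = bracket a y" "bracket a w' = bracket a w"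
    "bracket y' w' = 0"
proof -
  obtain \<alpha> \<beta> where yw: "bracket y w = \<alpha> *s bracket a y + \<beta> *s bracket a w"
    using assms by (auto simp: span_insert algebra_simps)
  \<comment> \<open>The two shifts contribute \<open>\<alpha> [y,a] = - \<alpha> [a,y]\<close> and \<open>- \<beta> [a,w]\<close>.\<close>
  have "bracket (y + (- \<beta>) *s a) (w + \<alpha> *s a)
      = bracket y w + \<alpha> *s bracket y a - \<beta> *s bracket a w"
    unfolding bracket_add_left bracket_add_right bracket_scale_left bracket_scale_right
      bracket_self by simp
  also have "\<dots> = 0"
    by (simp add: yw bracket_antisym[of y a])
  finally have "bracket (y + (- \<beta>) *s a) (w + \<alpha> *s a) = 0" .
  moreover have "bracket a (v + c *s a) = bracket a v" for v c
    by (simp add: bracket_add_right bracket_scale_right bracket_self)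
  ultimately show ?thesis
    using that by blast
qed

text \<open>The elements listed after each \<open>x\<^sub>i\<close> span a space on which some bracket condition holds that
  \<open>x\<^sub>i\<close> violates.\<close>

lemma independent_of_relations:
  assumes ind: "independent {z1, z2}" and ne: "z1 \<noteq> z2"
    and z: "z1 \<in> center" "z2 \<in> center"
    and rel: "bracket x1 x2 = z1" "bracket x1 x3 = z2" "bracket x2 x3 = 0"
  shows "independent {x1, x2, x3, z1, z2}" "distinct [x1, x2, x3, z1, z2]"
proof -
  have z0: "z1 \<noteq> 0" "z2 \<noteq> 0"
    using ind dependent_zero by blast+
  have z_right: "bracket x z1 = 0" "bracket x z2 = 0" for x
    using z by (auto simp: center_def)
  have "span {z1, z2} \<subseteq> {v. bracket x1 v = 0}"
    by (rule span_minimal) (auto simp: z_right subspace_centralizer)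
  then have x3: "x3 \<notin> span {z1, z2}"
    using rel z0 by auto
  have "span {x3, z1, z2} \<subseteq> {v. bracket x1 v \<in> span {z2}}"
    by (rule span_minimal)
      (auto simp: z_right rel span_base span_zero intro: subspace_preimage_ad)
  moreover have "z1 \<notin> span {z2}"
    using ind ne by (auto simp: dependent_def)
  ultimately have x2: "x2 \<notin> span {x3, z1, z2}"
    using rel by auto
  have "span {x2, x3, z1, z2} \<subseteq> {v. bracket x2 v = 0}"
    by (rule span_minimal) (auto simp: z_right rel bracket_self subspace_centralizer)
  moreover have "bracket x2 x1 \<noteq> 0"
    using rel z0 bracket_antisym[of x2 x1] by simp
  ultimately have x1: "x1 \<notin> span {x2, x3, z1, z2}"
    by auto
  show "independent {x1, x2, x3, z1, z2}"
    by (rule independent_insertI[OF x1 independent_insertI[OF x2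
            independent_insertI[OF x3 ind]]])
  have "x1 \<notin> {x2, x3, z1, z2}" "x2 \<notin> {x3, z1, z2}" "x3 \<notin> {z1, z2}"
    using x1 x2 x3 by (metis span_base)+
  then show "distinct [x1, x2, x3, z1, z2]"
    using ne by simp
qed

end

theorem theorem4p6:
  fixes scale :: "'a::field \<Rightarrow> 'b::ab_group_add \<Rightarrow> 'b"
    and bracket :: "'b \<Rightarrow> 'b \<Rightarrow> 'b"
  assumes "CHAR('a) \<noteq> 2"
    and "lie_algebra scale bracket"
    and "vector_space.dim scale (UNIV :: 'b set) = 5"
    and "lie_algebra.pure scale bracket"
    and "lie_algebra.nilpotent scale bracket"
    and "lie_algebra.breadth scale bracket = 2"
    and "vector_space.dim scale (lie_algebra.center bracket) = 2"
    and "vector_space.dim scale (lie_algebra.derived scale bracket) = 2"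
  shows "\<exists>x1 x2 x3 z1 z2.
    distinct [x1, x2, x3, z1, z2] \<and>
    \<not> module.dependent scale {x1, x2, x3, z1, z2} \<and>
    module.span scale {x1, x2, x3, z1, z2} = UNIV \<and>
    bracket x1 x2 = z1 \<and> bracket x1 x3 = z2 \<and>
    bracket x1 z1 = 0 \<and> bracket x1 z2 = 0 \<and>
    bracket x2 x3 = 0 \<and> bracket x2 z1 = 0 \<and> bracket x2 z2 = 0 \<and>
    bracket x3 z1 = 0 \<and> bracket x3 z2 = 0 \<and>
    bracket z1 z2 = 0"
proof -
  interpret lie_algebra scale bracket
    by fact
  obtain B where B: "independent B" "span B = UNIV" "card B = 5"
    using basis_exists[of UNIV] assms(3) by (metis top.extremum_unique)
  then have "finite B"
    by (metis card.infinite zero_neq_numeral)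
  then interpret finite_dimensional_vector_space scale B
    using B by unfold_locales auto
  have center_derived: "center = derived"
    by (rule subspace_dim_equal)
      (simp_all add: subspace_center subspace_derived assms pure_imp_center_subset_derived)
  obtain a where "dim (range (ad a)) = breadth"
    by (rule breadth_attained[OF dim_subset_UNIV])
  then have "dim (range (ad a)) = 2"
    using assms(6) by simp
  moreover have "range (ad a) \<subseteq> derived"
    by (auto simp: ad_def bracket_in_derived)
  ultimately have ad_onto: "range (ad a) = derived"
    by (intro subspace_dim_equal) (simp_all add: subspace_range_ad subspace_derived assms)
  obtain D where D: "D \<subseteq> derived" "independent D" "derived \<subseteq> span D" "card D = 2"
    using basis_exists[of derived] assms(8) by metis
  then obtain z1 z2 where z: "D = {z1, z2}" "z1 \<noteq> z2"
    by (meson card_2_iff)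
  then obtain y w where yw: "bracket a y = z1" "bracket a w = z2"
    using D(1) unfolding ad_onto[symmetric] ad_def by auto
  have "bracket y w \<in> span {bracket a y, bracket a w}"
    using bracket_in_derived D(3) z(1) yw by blast
  then obtain x2 x3 where x: "bracket a x2 = z1" "bracket a x3 = z2" "bracket x2 x3 = 0"
    using commuting_modification yw by metis
  have z_center: "z1 \<in> center" "z2 \<in> center"
    using D(1) z(1) center_derived by auto
  have ind: "independent {a, x2, x3, z1, z2}" and dist: "distinct [a, x2, x3, z1, z2]"
    using independent_of_relations[OF _ z(2) z_center x] D(2) z(1) by auto
  have "card {a, x2, x3, z1, z2} = dim UNIV"
    using distinct_card[OF dist] assms(3) by simp
  then have "span {a, x2, x3, z1, z2} = UNIV"
    using card_eq_dim[of "{a, x2, x3, z1, z2}" UNIV] ind by auto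
  then show ?thesis
    using ind dist x z_center unfolding center_def by blast
qed

end
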